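(* For the polynomial $1+x+y+z$ in the three variables $x,y,z$, $$c(1+x+y+z)=\frac{1}{4}.$$
   Context: For a polynomial $P(x_1,\ldots,x_k)\in\mathbb{C}[x_1,\ldots,x_k]$ of degree $d_j\ge 1$ in $x_j$, the alternative measure with respect to $x_j$ is $$c_j(P):=\frac{1}{d_j}\int_0^1\cdots\int_0^1\frac{\frac{\partial P}{\partial x_j}(e^{2\pi i t_1},\ldots,e^{2\pi i t_k})\,e^{2\pi i t_j}}{P(e^{2\pi i t_1},\ldots,e^{2\pi i t_k})}\,dt_1\cdots dt_k,$$ where the integral is a Lebesgue integral over $[0,1]^k$ (the integrand need only be defined almost everywhere and integrable). Without a subscript, $c(P)$ means $c_k(P)$, i.e. the measure with respect to the last variable. In particular $c(1+x+y+z)=\int_0^1\int_0^1\int_0^1 \frac{e^{2\pi i t_3}}{1+e^{2\pi i t_1}+e^{2\pi i t_2}+e^{2\pi i t_3}}\,dt_1\,dt_2\,dt_3$. *)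

theory Defs
  imports "HOL-Analysis.Analysis" "HOL-Library.Poly_Mapping"
begin

text \<open>
  Complex polynomials in variables indexed by natural numbers: an exponent vector
  \<open>m :: nat \<Rightarrow>\<^sub>0 nat\<close> stands for the monomial \<open>\<Prod>i. x\<^sub>i ^ lookup m i\<close>. The ring operations
  are those of \<open>Poly_Mapping\<close>. An element of \<open>\<complex>[x\<^sub>1, \<dots>, x\<^sub>k]\<close> is such a polynomial involving
  only the indices \<open>1, \<dots>, k\<close>.
\<close>

type_synonym cpoly = "(nat \<Rightarrow>\<^sub>0 nat) \<Rightarrow>\<^sub>0 complex"

definition Var :: "nat \<Rightarrow> cpoly" where
  "Var i = Poly_Mapping.single (Poly_Mapping.single i 1) 1"

definition poly_eval :: "cpoly \<Rightarrow> (nat \<Rightarrow> complex) \<Rightarrow> complex" where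
  "poly_eval P v =
    (\<Sum>m\<in>Poly_Mapping.keys P. Poly_Mapping.lookup P m *
       (\<Prod>i\<in>Poly_Mapping.keys m. v i ^ Poly_Mapping.lookup m i))"

text \<open>The zero polynomial gets degree 0.\<close>

definition degree_in :: "nat \<Rightarrow> cpoly \<Rightarrow> nat" where
  "degree_in j P = Max (insert 0 ((\<lambda>m. Poly_Mapping.lookup m j) ` Poly_Mapping.keys P))"

text \<open>
  Formal partial derivative. If \<open>x\<^sub>j\<close> does not occur in \<open>m\<close>, the truncated subtraction of
  exponents is harmless, since the coefficient vanishes.
\<close>

definition partial_deriv :: "nat \<Rightarrow> cpoly \<Rightarrow> cpoly" where
  "partial_deriv j P =
    (\<Sum>m\<in>Poly_Mapping.keys P.
       Poly_Mapping.single (m - Poly_Mapping.single j 1)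
         (of_nat (Poly_Mapping.lookup m j) * Poly_Mapping.lookup P m))"

definition torus_point :: "(nat \<Rightarrow> real) \<Rightarrow> nat \<Rightarrow> complex" where
  "torus_point t = (\<lambda>i. exp (2 * of_real pi * \<i> * of_real (t i)))"

text \<open>
  The alternative measure of \<open>P \<in> \<complex>[x\<^sub>1, \<dots>, x\<^sub>k]\<close> with respect to \<open>x\<^sub>j\<close>, where \<open>1 \<le> j \<le> k\<close> and
  \<open>degree_in j P \<ge> 1\<close>. Points of \<open>[0,1]\<^sup>k\<close> are extensional functions on \<open>{1..k}\<close>. At zeros of
  \<open>P\<close> the integrand is 0 by the convention \<open>x / 0 = 0\<close>. The Bochner integral of a
  non-integrable function is 0, so any nonzero value includes the integrability claim.
\<close>

definition alt_measure_wrt :: "nat \<Rightarrow> nat \<Rightarrow> cpoly \<Rightarrow> complex" where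
  "alt_measure_wrt k j P =
    1 / of_nat (degree_in j P) *
    (LINT t : ({1..k} \<rightarrow>\<^sub>E {0..1}) | Pi\<^sub>M {1..k} (\<lambda>_. lborel).
       poly_eval (partial_deriv j P) (torus_point t) * torus_point t j
         / poly_eval P (torus_point t))"

definition alt_measure :: "nat \<Rightarrow> cpoly \<Rightarrow> complex" where
  "alt_measure k P = alt_measure_wrt k k P"

end

theory Submission
  imports Defs
begin

text \<open>
  Write \<open>P = 1 + x + y + z\<close>. The four integrals of \<open>1/P\<close>, \<open>x/P\<close>, \<open>y/P\<close>, \<open>z/P\<close> over the torus agree:
  the last three by permuting variables, and \<open>1/P\<close> becomes \<open>x/P\<close> under the measure-preserving
  substitution \<open>(x, y, z) \<mapsto> (1/x, y/x, z/x)\<close>. As they add up to 1, each equals \<open>1/4\<close>.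

  What remains is the integrability of \<open>1/P\<close>. With \<open>a = 1 + x + y\<close> one has
  \<open>\<bar>\<bar>a\<bar>\<^sup>2 - 1\<bar> = \<bar>x + y\<bar> \<bar>1 + x\<bar> \<bar>1 + y\<bar>\<close>, so this product is at most \<open>4 \<bar>P\<bar>\<close>; and \<open>\<bar>z - u\<bar> \<le> 2 \<bar>P\<bar>\<close>,
  where \<open>u\<close> is the unit vector closest to \<open>-a\<close>. Taking a geometric mean with weights \<open>1/4\<close> and \<open>3/4\<close>
  bounds \<open>1/\<bar>P\<bar>\<close> by sums of products of functions with singularities of order \<open>3/4\<close> in separate
  variables.
\<close>

subsection \<open>Arc length measure on the unit circle\<close>

text \<open>Normalised arc length, total mass 1, kept as a measure on all of \<open>complex\<close>.
  Norm 1 is therefore a property of almost every point (\<open>AE_circle_norm\<close>), and later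
  pointwise bounds enter through \<open>AE\<close>.\<close>

definition circle :: "complex measure" where
  "circle = distr (restrict_space lborel {0..1}) borel (\<lambda>t. cis (2 * pi * t))"

lemma sets_circle [measurable_cong, simp]: "sets circle = sets borel"
  by (simp add: circle_def)

lemma space_circle [simp]: "space circle = UNIV"
  by (simp add: circle_def)

lemma measurable_cis [measurable]:
  "f \<in> borel_measurable M \<Longrightarrow> (\<lambda>x. cis (f x)) \<in> borel_measurable M"
  unfolding cis_conv_exp by measurable

lemma nn_integral_circle:
  assumes [measurable]: "f \<in> borel_measurable borel"
  shows "(\<integral>\<^sup>+z. f z \<partial>circle) = (\<integral>\<^sup>+t. indicator {0..1} t * f (cis (2 * pi * t)) \<partial>lborel)"
proof -
  have "(\<integral>\<^sup>+z. f z \<partial>circle) = (\<integral>\<^sup>+t. f (cis (2 * pi * t)) \<partial>restrict_space lborel {0..1})"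
    unfolding circle_def
    by (rule nn_integral_distr) (auto intro!: measurable_restrict_space1)
  then show ?thesis
    by (simp add: nn_integral_restrict_space mult.commute)
qed

lemma integral_circle:
  fixes f :: "complex \<Rightarrow> 'a :: {banach, second_countable_topology}"
  assumes [measurable]: "f \<in> borel_measurable borel"
  shows "(\<integral>z. f z \<partial>circle) = (\<integral>t. indicator {0..1} t *\<^sub>R f (cis (2 * pi * t)) \<partial>lborel)"
proof -
  have "(\<integral>z. f z \<partial>circle) = (\<integral>t. f (cis (2 * pi * t)) \<partial>restrict_space lborel {0..1})"
    unfolding circle_def
    by (rule integral_distr) (auto intro!: measurable_restrict_space1)
  then show ?thesis
    by (simp add: integral_restrict_space)
qed

lemma emeasure_circle_space: "emeasure circle UNIV = 1"
  using nn_integral_circle[of "\<lambda>_. 1"] by simp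

lemma finite_measure_circle: "finite_measure circle"
  by (rule finite_measureI) (simp add: emeasure_circle_space)

interpretation circle: finite_measure circle
  by (rule finite_measure_circle)

lemma AE_circle_norm: "AE z in circle. norm z = 1"
proof -
  have "(\<lambda>t. cis (2 * pi * t)) \<in> restrict_space lborel {0..1} \<rightarrow>\<^sub>M borel"
    by (rule measurable_restrict_space1) measurable
  then show ?thesis
    unfolding circle_def by (subst AE_distr_iff) auto
qed

section \<open>Invariance under rotation and conjugation\<close>

lemma unit_complex_cis:
  assumes "norm u = 1"
  obtains c where "0 \<le> c" "c < 1" "u = cis (2 * pi * c)"
proof
  have u: "u = exp (\<i> * of_real (Arg2pi u))"
    using Arg2pi_eq[of u] assms by simp
  show "0 \<le> Arg2pi u / (2 * pi)" using Arg2pi_ge_0[of u] by simp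
  show "Arg2pi u / (2 * pi) < 1" using Arg2pi_lt_2pi[of u] by (simp add: field_simps)
  show "u = cis (2 * pi * (Arg2pi u / (2 * pi)))" using u by (simp add: cis_conv_exp)
qed

lemma cis_add_one: "cis (2 * pi * (t + 1)) = cis (2 * pi * t)"
  by (simp add: distrib_left flip: cis_mult)

text \<open>Rotation by \<open>cis (2 * pi * c)\<close> shifts the parameter by \<open>c\<close>.
  The integrand has period 1, so the part of the shifted interval beyond 1 moves back to the gap
  between 0 and \<open>c\<close>.\<close>

lemma nn_integral_circle_mult:
  assumes [measurable]: "f \<in> borel_measurable borel" and u: "norm u = 1"
  shows "(\<integral>\<^sup>+z. f (u * z) \<partial>circle) = (\<integral>\<^sup>+z. f z \<partial>circle)"
proof -
  obtain c where c: "0 \<le> c" "c < 1" "u = cis (2 * pi * c)"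
    using unit_complex_cis[OF u] .
  define F where "F t = f (cis (2 * pi * t))" for t :: real
  have [measurable]: "F \<in> borel_measurable borel" unfolding F_def by measurable
  have per: "F (t + 1) = F t" for t by (simp only: F_def cis_add_one)
  have "(\<integral>\<^sup>+z. f (u * z) \<partial>circle) = (\<integral>\<^sup>+t. indicator {0..1} t * F (t + c) \<partial>lborel)"
    by (subst nn_integral_circle) (auto simp: F_def c cis_mult algebra_simps)
  also have "\<dots> = (\<integral>\<^sup>+t. indicator {c..1 + c} t * F t \<partial>lborel)"
    by (subst (2) nn_integral_real_affine[of _ 1 c])
       (auto intro!: nn_integral_cong simp: indicator_def algebra_simps)
  also have "\<dots> = (\<integral>\<^sup>+t. indicator {c..1} t * F t + indicator {1<..1 + c} t * F t \<partial>lborel)"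
    using c by (intro nn_integral_cong) (auto simp: indicator_def)
  also have "\<dots> = (\<integral>\<^sup>+t. indicator {c..1} t * F t \<partial>lborel) + (\<integral>\<^sup>+t. indicator {1<..1 + c} t * F t \<partial>lborel)"
    by (rule nn_integral_add) auto
  also have "(\<integral>\<^sup>+t. indicator {1<..1 + c} t * F t \<partial>lborel) = (\<integral>\<^sup>+t. indicator {0<..c} t * F t \<partial>lborel)"
    by (subst nn_integral_real_affine[of _ 1 1])
       (auto intro!: nn_integral_cong simp: indicator_def per add.commute[of 1])
  also have "(\<integral>\<^sup>+t. indicator {c..1} t * F t \<partial>lborel) + \<dots> =
      (\<integral>\<^sup>+t. indicator {c..1} t * F t + indicator {0<..c} t * F t \<partial>lborel)"
    by (rule nn_integral_add[symmetric]) auto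
  also have "\<dots> = (\<integral>\<^sup>+t. indicator {0..1} t * F t \<partial>lborel)"
  proof (rule nn_integral_cong_AE)
    \<comment> \<open>For \<open>c > 0\<close> both pieces contain \<open>c\<close> and both miss 0;
      these two points form a null set.\<close>
    show "AE t in lborel. indicator {c..1} t * F t + indicator {0<..c} t * F t = indicator {0..1} t * F t"
      using AE_lborel_singleton[of 0] AE_lborel_singleton[of c]
      by eventually_elim (use c in \<open>auto simp: indicator_def\<close>)
  qed
  also have "\<dots> = (\<integral>\<^sup>+z. f z \<partial>circle)"
    by (subst nn_integral_circle) (auto simp: F_def)
  finally show ?thesis .
qed

text \<open>Conjugation is the reflection \<open>t \<mapsto> 1 - t\<close> of the parameter
  interval.\<close>

lemma nn_integral_circle_cnj:
  assumes [measurable]: "f \<in> borel_measurable borel"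
  shows "(\<integral>\<^sup>+z. f (cnj z) \<partial>circle) = (\<integral>\<^sup>+z. f z \<partial>circle)"
proof -
  have [measurable]: "cnj \<in> borel_measurable borel"
    by (intro borel_measurable_continuous_onI continuous_intros)
  have 1: "cis (2 * pi * (1 - t)) = cnj (cis (2 * pi * t))" for t
    by (simp add: complex_eq_iff right_diff_distrib cos_diff sin_diff)
  have "(\<integral>\<^sup>+z. f z \<partial>circle) = (\<integral>\<^sup>+t. indicator {0..1} t * f (cis (2 * pi * t)) \<partial>lborel)"
    by (rule nn_integral_circle) measurable
  also have "\<dots> = (\<integral>\<^sup>+t. indicator {0..1} (1 - t) * f (cis (2 * pi * (1 - t))) \<partial>lborel)"
    by (subst nn_integral_real_affine[of _ "-1" 1]) auto
  also have "\<dots> = (\<integral>\<^sup>+t. indicator {0..1} t * f (cnj (cis (2 * pi * t))) \<partial>lborel)"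
    by (intro nn_integral_cong) (auto simp: 1 indicator_def)
  also have "\<dots> = (\<integral>\<^sup>+z. f (cnj z) \<partial>circle)"
    by (rule nn_integral_circle[symmetric]) measurable
  finally show ?thesis by simp
qed

text \<open>Invariance of nonnegative integrals, tested on indicators, says that the image measure
  under \<open>g\<close> is \<open>circle\<close> itself. Bochner integrals follow, including the
  default value 0 of non-integrable functions.\<close>

lemma integral_circle_invariant:
  fixes f :: "complex \<Rightarrow> 'a :: {banach, second_countable_topology}"
  assumes [measurable]: "f \<in> borel_measurable borel" "g \<in> borel_measurable borel"
    and inv: "\<And>h. h \<in> borel_measurable borel \<Longrightarrow> (\<integral>\<^sup>+z. h (g z) \<partial>circle) = (\<integral>\<^sup>+z. h z \<partial>circle)"
  shows "(\<integral>z. f (g z) \<partial>circle) = (\<integral>z. f z \<partial>circle)"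
proof -
  have "distr circle borel g = circle"
  proof (rule measure_eqI)
    fix A assume "A \<in> sets (distr circle borel g)"
    then have [measurable]: "A \<in> sets borel" by simp
    have "emeasure (distr circle borel g) A = (\<integral>\<^sup>+z. indicator A z \<partial>distr circle borel g)"
      by simp
    also have "\<dots> = (\<integral>\<^sup>+z. indicator A (g z) \<partial>circle)"
      by (rule nn_integral_distr) auto
    also have "\<dots> = (\<integral>\<^sup>+z. indicator A z \<partial>circle)"
      by (rule inv) auto
    finally show "emeasure (distr circle borel g) A = emeasure circle A" by simp
  qed simp
  moreover have "integral\<^sup>L (distr circle borel g) f = (\<integral>z. f (g z) \<partial>circle)"
    by (rule integral_distr) auto
  ultimately show ?thesis by simp
qed

lemma integral_circle_mult:
  fixes f :: "complex \<Rightarrow> 'a :: {banach, second_countable_topology}"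
  assumes "f \<in> borel_measurable borel" "norm u = 1"
  shows "(\<integral>z. f (u * z) \<partial>circle) = (\<integral>z. f z \<partial>circle)"
  by (rule integral_circle_invariant) (use assms nn_integral_circle_mult in auto)

lemma integral_circle_cnj:
  fixes f :: "complex \<Rightarrow> 'a :: {banach, second_countable_topology}"
  assumes "f \<in> borel_measurable borel"
  shows "(\<integral>z. f (cnj z) \<partial>circle) = (\<integral>z. f z \<partial>circle)"
  by (rule integral_circle_invariant)
     (use assms nn_integral_circle_cnj in \<open>auto intro!: borel_measurable_continuous_onI continuous_intros\<close>)

subsection \<open>Integrability of the reciprocal\<close>

text \<open>Extended values are used so that \<open>sing 0 = \<infinity>\<close>; with real division it would be 0 and the pointwise bound on
  \<open>1/\<bar>P\<bar>\<close> would fail where a factor vanishes.\<close>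

definition sing :: "complex \<Rightarrow> ennreal" where
  "sing w = inverse (ennreal (norm w powr (3 / 4)))"

lemma measurable_sing [measurable]: "sing \<in> borel_measurable borel"
  unfolding sing_def by measurable

section \<open>Singularities of order 3/4 on the circle\<close>

lemma sin_ge_half:
  fixes x :: real
  assumes "0 \<le> x" "x \<le> pi / 2"
  shows "x / 2 \<le> sin x"
proof -
  have "\<bar>sin x - x\<bar> \<le> x ^ 3 / 6"
    using Maclaurin_sin_bound[of x 3] assms
    by (simp add: sin_coeff_def eval_nat_numeral field_simps)
  moreover have "x ^ 3 / 6 \<le> x / 2"
  proof -
    \<comment> \<open>The bound amounts to \<open>x * x \<le> 3\<close>; here
      \<open>pi / 2 < 1.7\<close> and \<open>1.7 * 1.7 = 2.89\<close>.\<close>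
    have "x \<le> 1.7" using assms pi_less_4 pi_approx by simp
    then have "x * x \<le> 1.7 * 1.7" using assms by (intro mult_mono) auto
    then have "x * (x * x) \<le> x * 3" using assms by (intro mult_left_mono) auto
    then show ?thesis by (simp add: eval_nat_numeral)
  qed
  ultimately show ?thesis by linarith
qed

text \<open>The chord from 1 has length \<open>2 * sin (pi * t)\<close>. For
  \<open>t \<le> 1/2\<close> this is at least \<open>pi * t\<close> by \<open>sin_ge_half\<close>,
  and \<open>t \<mapsto> 1 - t\<close> covers the other half.\<close>

lemma norm_cis_minus_one_ge:
  assumes "0 \<le> t" "t \<le> 1"
  shows "min t (1 - t) \<le> norm (cis (2 * pi * t) - 1)"
proof -
  have "(norm (cis (2 * pi * t) - 1))\<^sup>2 = (2 * sin (pi * t))\<^sup>2"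
  proof -
    have "(cos (2 * (pi * t)) - 1)\<^sup>2 + (sin (2 * (pi * t)))\<^sup>2 = 2 - 2 * cos (2 * (pi * t))"
      using sin_cos_squared_add[of "2 * (pi * t)"] by (simp add: power2_diff)
    then show ?thesis
      by (simp add: cmod_power2 cos_double_sin power_mult_distrib mult.assoc)
  qed
  moreover have s: "0 \<le> sin (pi * t)" by (rule sin_ge_zero) (use assms in \<open>auto simp: mult_left_le\<close>)
  ultimately have n: "norm (cis (2 * pi * t) - 1) = 2 * sin (pi * t)"
    by (metis norm_ge_zero mult_nonneg_nonneg power2_eq_iff_nonneg zero_le_numeral)
  have a: "r \<le> 2 * sin (pi * r)" if "0 \<le> r" "r \<le> 1/2" for r
  proof -
    have "pi * r / 2 \<le> sin (pi * r)" by (rule sin_ge_half) (use that in auto)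
    moreover have "1 * r \<le> pi * r" using that pi_gt3 by (intro mult_right_mono) auto
    ultimately show ?thesis by linarith
  qed
  show ?thesis
  proof (cases "t \<le> 1/2")
    case True
    then show ?thesis using a[of t] assms n by auto
  next
    case False
    have "sin (pi * (1 - t)) = sin (pi * t)" by (simp add: right_diff_distrib sin_diff)
    then show ?thesis using False a[of "1 - t"] assms n by auto
  qed
qed

text \<open>The point 1 is reached at both ends of the parameter interval. The chord bound dominates
  \<open>sing\<close> by one power of exponent -3/4 at each end, and since the exponent exceeds -1
  each has a finite integral, namely 4.\<close>

lemma nn_integral_sing_finite: "(\<integral>\<^sup>+z. sing (z - 1) \<partial>circle) < \<infinity>"
proof -
  define p where "p t = ennreal (t powr (-3/4))" for t :: real
  have [measurable]: "p \<in> borel_measurable borel" unfolding p_def by measurable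
  have p: "(\<integral>\<^sup>+t. indicator {0..1} t * p t \<partial>lborel) = 4"
  proof -
    have "((\<lambda>x::real. x powr (-3/4)) has_integral 4) {0..1}"
      using has_integral_powr_from_0[of "-3/4" 1] by simp
    from nn_integral_has_integral_lebesgue'[OF _ this] show ?thesis
      by (simp add: p_def mult.commute)
  qed
  have p': "(\<integral>\<^sup>+t. indicator {0..1} t * p (1 - t) \<partial>lborel) = 4"
    unfolding p[symmetric]
    by (subst (2) nn_integral_real_affine[of _ "-1" 1])
       (auto intro!: nn_integral_cong simp: indicator_def)
  have "(\<integral>\<^sup>+z. sing (z - 1) \<partial>circle) = (\<integral>\<^sup>+t. indicator {0..1} t * sing (cis (2 * pi * t) - 1) \<partial>lborel)"
    by (rule nn_integral_circle) measurable
  also have "\<dots> \<le> (\<integral>\<^sup>+t. indicator {0..1} t * p t + indicator {0..1} t * p (1 - t) \<partial>lborel)"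
  proof (rule nn_integral_mono_AE)
    \<comment> \<open>The bound fails at the endpoints, where \<open>sing 0 = \<infinity>\<close>
      but \<open>0 powr (-3/4) = 0\<close>; they are discarded as a null set.\<close>
    show "AE t in lborel. indicator {0..1} t * sing (cis (2 * pi * t) - 1)
        \<le> indicator {0..1} t * p t + indicator {0..1} t * p (1 - t)"
      using AE_lborel_singleton[of 0] AE_lborel_singleton[of 1]
    proof eventually_elim
      case (elim t)
      show ?case
      proof (cases "0 < t \<and> t < 1")
        case True
        let ?m = "min t (1 - t)"
        let ?n = "norm (cis (2 * pi * t) - 1)"
        have m: "0 < ?m" "?m \<le> ?n"
          using True by (auto intro!: norm_cis_minus_one_ge simp del: min_le_iff_disj)
        then have "?m powr (3/4) \<le> ?n powr (3/4)"
          by (intro powr_mono2) auto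
        then have "inverse (?n powr (3/4)) \<le> inverse (?m powr (3/4))"
          using m by (intro le_imp_inverse_le) auto
        moreover have "0 < ?n" using m by linarith
        ultimately have "sing (cis (2 * pi * t) - 1) \<le> p ?m"
          unfolding sing_def p_def by (simp add: inverse_ennreal powr_minus ennreal_leI)
        also have "\<dots> \<le> p t + p (1 - t)"
          by (simp add: min_def)
        finally show ?thesis using True by (simp add: indicator_def)
      next
        case False
        then show ?thesis using elim by (auto simp: indicator_def)
      qed
    qed
  qed
  also have "\<dots> = 8"
    by (subst nn_integral_add) (auto simp: p p')
  also have "\<dots> < \<infinity>" by simp
  finally show ?thesis .
qed

definition sing_mass :: ennreal where "sing_mass = (\<integral>\<^sup>+z. sing (z - 1) \<partial>circle)"

lemma sing_mass_finite: "sing_mass < \<infinity>"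
  unfolding sing_mass_def by (rule nn_integral_sing_finite)

text \<open>Rotating by \<open>u\<close> carries the singularity from 1 to \<open>u\<close> and
  preserves distances, so one constant serves every centre on the circle.\<close>

lemma nn_integral_sing:
  assumes u: "norm u = 1"
  shows "(\<integral>\<^sup>+z. sing (z - u) \<partial>circle) = sing_mass"
proof -
  have "(\<integral>\<^sup>+z. sing (z - u) \<partial>circle) = (\<integral>\<^sup>+z. sing (u * z - u) \<partial>circle)"
    by (rule nn_integral_circle_mult[symmetric]) (use u in auto)
  also have "\<dots> = sing_mass"
  proof -
    have "norm (u * z - u) = norm (z - 1)" for z
      using u by (metis mult.right_neutral norm_mult mult_1 right_diff_distrib)
    then show ?thesis unfolding sing_mass_def sing_def by simp
  qed
  finally show ?thesis .
qed

text \<open>The left side is the distance of \<bar>a\<bar>^2 from 1, where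
  \<open>a = 1 + x + y\<close>. It splits as (\<bar>a\<bar> + 1) times the distance of \<bar>a\<bar>
  from 1: the first factor is at most 4, and the second at most \<open>norm (a + z)\<close> because
  \<open>z\<close> has norm 1.\<close>

lemma product_le_norm_one_plus_sum:
  fixes x y z :: complex
  assumes x: "norm x = 1" and y: "norm y = 1" and z: "norm z = 1"
  shows "norm (x + y) * norm (1 + x) * norm (1 + y) \<le> 4 * norm (1 + x + y + z)"
proof -
  define a where "a = 1 + x + y"
  have "x * cnj x = 1" "y * cnj y = 1"
    using x y by (simp_all add: complex_norm_square[symmetric])
  \<comment> \<open>With \<open>cnj x = 1/x\<close>, \<open>cnj y = 1/y\<close>, s = x + y and q =
    xy, this is (1 + s)(q + s) - q = s(1 + s + q), divided by q.\<close>
  then have "(1 + x + y) * (1 + cnj x + cnj y) - 1 = (x + y) * (1 + x) * (1 + y) * (cnj x * cnj y)"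
    by algebra
  then have "a * cnj a - 1 = (x + y) * (1 + x) * (1 + y) * (cnj x * cnj y)"
    by (simp add: a_def)
  then have "norm (a * cnj a - 1) = norm (x + y) * norm (1 + x) * norm (1 + y)"
    using x y by (simp add: norm_mult)
  moreover have "a * cnj a - 1 = of_real ((norm a)\<^sup>2 - 1)"
    by (simp add: complex_norm_square del: of_real_power)
  ultimately have "norm (x + y) * norm (1 + x) * norm (1 + y) = \<bar>(norm a)\<^sup>2 - 1\<bar>"
    by (metis norm_of_real)
  also have "\<dots> = (norm a + 1) * \<bar>norm a - 1\<bar>"
  proof -
    have "(norm a)\<^sup>2 - 1 = (norm a + 1) * (norm a - 1)" by (simp add: power2_eq_square algebra_simps)
    then show ?thesis by (simp add: abs_mult)
  qed
  also have "\<dots> \<le> 4 * norm (a + z)"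
  proof (rule mult_mono)
    have "norm a \<le> norm (1 + x) + norm y" unfolding a_def by (rule norm_triangle_ineq)
    also have "norm (1 + x) \<le> norm (1 :: complex) + norm x" by (rule norm_triangle_ineq)
    finally show "norm a + 1 \<le> 4" using x y by simp
    show "\<bar>norm a - 1\<bar> \<le> norm (a + z)"
      using norm_triangle_ineq3[of a "- z"] z by simp
  qed auto
  finally show ?thesis by (simp add: a_def)
qed

text \<open>For \<open>a \<noteq> 0\<close> the radial projection of \<open>-a\<close> works:
  \<open>norm (a + u)\<close> is the distance of \<bar>a\<bar> from 1, hence at most
  \<open>norm (a + z)\<close>, and the triangle inequality doubles it. For \<open>a = 0\<close> any
  unit vector serves.\<close>

lemma unit_nearest:
  fixes a :: complex
  obtains u where "norm u = 1" "\<And>z. norm z = 1 \<Longrightarrow> norm (z - u) \<le> 2 * norm (a + z)"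
proof (cases "a = 0")
  case True
  have "norm (z - 1) \<le> 2 * norm (a + z)" if "norm z = 1" for z :: complex
    using norm_triangle_ineq4[of z 1] that True by simp
  then show ?thesis using that[of 1] by simp
next
  case False
  define u where "u = - (a / of_real (norm a))"
  have u: "norm u = 1" using False by (simp add: u_def norm_divide)
  have "norm (z - u) \<le> 2 * norm (a + z)" if z: "norm z = 1" for z
  proof -
    have "a + u = of_real (norm a - 1) * (a / of_real (norm a))"
      using False by (simp add: u_def field_simps)
    then have "norm (a + u) = \<bar>norm a - 1\<bar>"
      using False by (simp add: norm_mult norm_divide del: of_real_diff)
    also have "\<dots> \<le> norm (a + z)"
      using norm_triangle_ineq3[of a "- z"] z by simp
    finally have "norm (a + u) \<le> norm (a + z)" .
    moreover have "norm (z - u) \<le> norm (a + z) + norm (a + u)"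
      using norm_triangle_ineq4[of "a + z" "a + u"] by simp
    ultimately show ?thesis by simp
  qed
  then show ?thesis using that u by blast
qed

text \<open>The weighted geometric mean: with A and B the 3/4 powers of the two norms, (AB)^4 is at
  most (2p)^3 * 4p = 32 p^4, which is below (4p)^4. This gives the factor 4.\<close>

lemma inverse_le_sing_mult:
  assumes v: "norm v \<le> 2 * p" and w: "norm w ^ 3 \<le> 4 * p"
  shows "inverse (ennreal p) \<le> 4 * sing v * sing w"
proof (cases "v = 0 \<or> w = 0")
  case True
  \<comment> \<open>One factor is infinite and no \<open>sing\<close> value is 0, so the product
    cannot collapse through \<open>0 * \<infinity> = 0\<close>.\<close>
  have "sing q \<noteq> 0" for q by (simp add: sing_def)
  moreover have "sing 0 = \<infinity>" by (simp add: sing_def)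
  ultimately have "4 * sing v * sing w = \<infinity>"
    using True by (auto simp: ennreal_mult_eq_top_iff ennreal_top_mult ennreal_mult_top less_le)
  then show ?thesis by simp
next
  case False
  define A B where "A = norm v powr (3/4)" and "B = norm w powr (3/4)"
  have pos: "A > 0" "B > 0" "p > 0"
    using False v by (auto simp: A_def B_def intro: less_le_trans zero_less_norm_iff[THEN iffD2])
      (smt (verit) zero_less_norm_iff)
  have "A ^ 4 = norm v ^ 3" "B ^ 4 = norm w ^ 3"
    using False by (simp_all add: A_def B_def powr_power powr_numeral)
  then have "(A * B) ^ 4 = norm v ^ 3 * norm w ^ 3"
    by (simp add: power_mult_distrib)
  also have "\<dots> \<le> (2 * p) ^ 3 * (4 * p)"
    using v w pos by (intro mult_mono power_mono) auto
  also have "\<dots> = 32 * p ^ 4" by (simp add: eval_nat_numeral)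
  also have "\<dots> \<le> (4 * p) ^ 4" using pos by (simp add: power_mult_distrib)
  finally have "A * B \<le> 4 * p"
    by (rule power_le_imp_le_base[of _ 3, simplified]) (use pos in auto)
  then have "inverse p \<le> 4 * inverse A * inverse B"
    using pos by (simp add: field_simps)
  then have "ennreal (inverse p) \<le> ennreal (4 * inverse A * inverse B)"
    by (rule ennreal_leI)
  also have "\<dots> = 4 * sing v * sing w"
    using pos by (simp add: ennreal_mult sing_def inverse_ennreal flip: A_def B_def)
  finally show ?thesis using pos by (simp add: inverse_ennreal)
qed

text \<open>The smallest of the three factors has its cube below their product, so it can serve as
  \<open>w\<close> in \<open>inverse_le_sing_mult\<close>. Which factor is smallest varies with the
  point; the sum over all three covers every case and integrates term by term.\<close>

lemma inverse_norm_le_sing: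
  assumes x: "norm x = 1" and y: "norm y = 1" and z: "norm z = 1"
    and u: "norm (z - u) \<le> 2 * norm (1 + x + y + z)"
  shows "inverse (ennreal (norm (1 + x + y + z))) \<le>
    4 * sing (z - u) * (sing (x + y) + sing (1 + x) + sing (1 + y))"
proof -
  let ?p = "norm (1 + x + y + z)"
  let ?m = "min (norm (x + y)) (min (norm (1 + x)) (norm (1 + y)))"
  have "?m * ?m * ?m \<le> norm (x + y) * norm (1 + x) * norm (1 + y)"
    by (intro mult_mono) auto
  also have "\<dots> \<le> 4 * ?p"
    by (rule product_le_norm_one_plus_sum) fact+
  finally have "?m ^ 3 \<le> 4 * ?p"
    by (simp only: power3_eq_cube)
  moreover obtain w where "?m = norm w" and w: "w \<in> {x + y, 1 + x, 1 + y}"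
  proof -
    have "?m \<in> norm ` {x + y, 1 + x, 1 + y}" unfolding min_def by simp
    then show ?thesis using that by blast
  qed
  ultimately have "inverse (ennreal ?p) \<le> 4 * sing (z - u) * sing w"
    using u by (intro inverse_le_sing_mult) auto
  also have "\<dots> \<le> 4 * sing (z - u) * (sing (x + y) + sing (1 + x) + sing (1 + y))"
    using w by (intro mult_left_mono) (auto simp: add_increasing add_increasing2)
  finally show ?thesis .
qed

text \<open>The innermost integral is taken first. The centre \<open>u\<close> depends on
  \<open>x\<close> and \<open>y\<close>, but its contribution is always \<open>sing_mass\<close>, so
  the choice of \<open>u\<close> leaves no trace in the outer integrals. Every remaining term is
  constant or singular at a single unit point.\<close>

lemma nn_integral_inverse_norm_finite:
  "(\<integral>\<^sup>+x. \<integral>\<^sup>+y. \<integral>\<^sup>+z. inverse (ennreal (norm (1 + x + y + z))) \<partial>circle \<partial>circle \<partial>circle) < \<infinity>"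
proof -
  let ?S = "\<lambda>x y. sing (x + y) + sing (1 + x) + sing (1 + y)"
  have sing_plus: "(\<integral>\<^sup>+z. sing (u + z) \<partial>circle) = sing_mass" if "norm u = 1" for u
    using nn_integral_sing[of "- u"] that by (simp add: add.commute)
  have z: "(\<integral>\<^sup>+z. inverse (ennreal (norm (1 + x + y + z))) \<partial>circle) \<le> 4 * sing_mass * ?S x y"
    if "norm x = 1" "norm y = 1" for x y
  proof -
    obtain u where u: "norm u = 1" "\<And>z. norm z = 1 \<Longrightarrow> norm (z - u) \<le> 2 * norm (1 + x + y + z)"
      using unit_nearest[of "1 + x + y"] by blast
    have "(\<integral>\<^sup>+z. inverse (ennreal (norm (1 + x + y + z))) \<partial>circle) \<le>
        (\<integral>\<^sup>+z. 4 * sing (z - u) * ?S x y \<partial>circle)"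
    proof (rule nn_integral_mono_AE)
      show "AE z in circle. inverse (ennreal (norm (1 + x + y + z))) \<le> 4 * sing (z - u) * ?S x y"
        using AE_circle_norm by eventually_elim (intro inverse_norm_le_sing u that)
    qed
    also have "\<dots> = 4 * sing_mass * ?S x y"
      by (simp add: nn_integral_multc nn_integral_cmult nn_integral_sing u)
    finally show ?thesis .
  qed
  have y: "(\<integral>\<^sup>+y. 4 * sing_mass * ?S x y \<partial>circle) = 4 * sing_mass * (2 * sing_mass + sing (1 + x))"
    if "norm x = 1" for x
  proof -
    have "(\<integral>\<^sup>+y. 4 * sing_mass * ?S x y \<partial>circle) = 4 * sing_mass * (\<integral>\<^sup>+y. ?S x y \<partial>circle)"
      by (rule nn_integral_cmult) measurable
    also have "(\<integral>\<^sup>+y. ?S x y \<partial>circle) = sing_mass + sing (1 + x) + sing_mass"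
      using that by (simp add: nn_integral_add sing_plus emeasure_circle_space)
    also have "sing_mass + sing (1 + x) + sing_mass = 2 * sing_mass + sing (1 + x)"
      by (simp add: mult_2 add_ac)
    finally show ?thesis .
  qed
  have "(\<integral>\<^sup>+x. \<integral>\<^sup>+y. \<integral>\<^sup>+z. inverse (ennreal (norm (1 + x + y + z))) \<partial>circle \<partial>circle \<partial>circle) \<le>
      (\<integral>\<^sup>+x. 4 * sing_mass * (2 * sing_mass + sing (1 + x)) \<partial>circle)"
  proof (rule nn_integral_mono_AE)
    show "AE x in circle. (\<integral>\<^sup>+y. \<integral>\<^sup>+z. inverse (ennreal (norm (1 + x + y + z))) \<partial>circle \<partial>circle) \<le>
        4 * sing_mass * (2 * sing_mass + sing (1 + x))"
      using AE_circle_norm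
    proof eventually_elim
      case (elim x)
      have "(\<integral>\<^sup>+y. \<integral>\<^sup>+z. inverse (ennreal (norm (1 + x + y + z))) \<partial>circle \<partial>circle) \<le>
          (\<integral>\<^sup>+y. 4 * sing_mass * ?S x y \<partial>circle)"
        by (rule nn_integral_mono_AE, use AE_circle_norm in eventually_elim) (rule z[OF elim])
      then show ?case by (simp only: y[OF elim])
    qed
  qed
  also have "\<dots> = 4 * sing_mass * (\<integral>\<^sup>+x. 2 * sing_mass + sing (1 + x) \<partial>circle)"
    by (rule nn_integral_cmult) measurable
  also have "(\<integral>\<^sup>+x. 2 * sing_mass + sing (1 + x) \<partial>circle) = 2 * sing_mass + sing_mass"
    by (simp add: nn_integral_add sing_plus emeasure_circle_space)
  also have "4 * sing_mass * (2 * sing_mass + sing_mass) < \<infinity>"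
    using sing_mass_finite by (simp add: ennreal_mult_less_top)
  finally show ?thesis .
qed

subsection \<open>Iterated integrals in an arbitrary order\<close>

lemma product_sigma_finite_lborel: "product_sigma_finite (\<lambda>_. lborel)"
  by unfold_locales

text \<open>The product measure depends only on the set of indices, while the order
  \<open>a\<close>, \<open>b\<close>, \<open>c\<close> fixes the order of integration. Choosing
  another order is how variables are interchanged later.\<close>

lemma nn_integral_PiM_three:
  fixes F :: "real \<times> real \<times> real \<Rightarrow> ennreal" and a b c :: 'i
  assumes abc: "distinct [a, b, c]"
    and [measurable]: "F \<in> borel_measurable (borel \<Otimes>\<^sub>M borel \<Otimes>\<^sub>M borel)"
  shows "(\<integral>\<^sup>+t. F (t a, t b, t c) \<partial>Pi\<^sub>M {a, b, c} (\<lambda>_. lborel)) =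
    (\<integral>\<^sup>+r. \<integral>\<^sup>+s. \<integral>\<^sup>+t. F (r, s, t) \<partial>lborel \<partial>lborel \<partial>lborel)"
proof -
  interpret product_sigma_finite "\<lambda>_ :: 'i. lborel :: real measure"
    by (rule product_sigma_finite_lborel)
  have "{a, b, c} = insert c (insert b {a})" by auto
  then have "(\<integral>\<^sup>+t. F (t a, t b, t c) \<partial>Pi\<^sub>M {a, b, c} (\<lambda>_. lborel)) =
      (\<integral>\<^sup>+t. F (t a, t b, t c) \<partial>Pi\<^sub>M (insert c (insert b {a})) (\<lambda>_. lborel))"
    by (simp only:)
  also have "\<dots> = (\<integral>\<^sup>+r. \<integral>\<^sup>+t. F (r a, r b, t) \<partial>lborel \<partial>Pi\<^sub>M (insert b {a}) (\<lambda>_. lborel))"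
    using abc by (subst product_nn_integral_insert) auto
  also have "\<dots> = (\<integral>\<^sup>+r. \<integral>\<^sup>+s. \<integral>\<^sup>+t. F (r a, s, t) \<partial>lborel \<partial>lborel \<partial>Pi\<^sub>M {a} (\<lambda>_. lborel))"
    using abc by (subst product_nn_integral_insert) auto
  also have "\<dots> = (\<integral>\<^sup>+r. \<integral>\<^sup>+s. \<integral>\<^sup>+t. F (r, s, t) \<partial>lborel \<partial>lborel \<partial>lborel)"
    by (rule product_nn_integral_singleton) measurable
  finally show ?thesis .
qed

text \<open>For non-integrable \<open>f\<close> the left side is 0 by convention.\<close>

lemma norm_integral_le_nn_integral:
  fixes f :: "'b \<Rightarrow> 'a :: {banach, second_countable_topology}"
  shows "ennreal (norm (\<integral>x. f x \<partial>M)) \<le> (\<integral>\<^sup>+x. norm (f x) \<partial>M)"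
  by (cases "integrable M f") (auto simp: integral_norm_bound_ennreal not_integrable_integral_eq)

lemma integral_PiM_three:
  fixes F :: "real \<times> real \<times> real \<Rightarrow> 'a :: {banach, second_countable_topology}" and a b c :: 'i
  assumes abc: "distinct [a, b, c]"
    and [measurable]: "F \<in> borel_measurable (borel \<Otimes>\<^sub>M borel \<Otimes>\<^sub>M borel)"
    and int: "integrable (Pi\<^sub>M {a, b, c} (\<lambda>_. lborel)) (\<lambda>t. F (t a, t b, t c))"
  shows "(\<integral>t. F (t a, t b, t c) \<partial>Pi\<^sub>M {a, b, c} (\<lambda>_. lborel)) =
    (\<integral>r. \<integral>s. \<integral>t. F (r, s, t) \<partial>lborel \<partial>lborel \<partial>lborel)"
proof -
  interpret product_sigma_finite "\<lambda>_ :: 'i. lborel :: real measure"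
    by (rule product_sigma_finite_lborel)
  have eq: "{a, b, c} = insert c (insert b {a})" by auto
  note int' = int[unfolded eq]
  let ?G = "\<lambda>r s. \<integral>t. F (r, s, t) \<partial>lborel"
  \<comment> \<open>Splitting off the second coordinate requires the inner integral to be integrable
    in the remaining two.\<close>
  have "(\<integral>\<^sup>+r. norm (?G (r a) (r b)) \<partial>Pi\<^sub>M (insert b {a}) (\<lambda>_. lborel)) \<le>
      (\<integral>\<^sup>+r. \<integral>\<^sup>+t. norm (F (r a, r b, t)) \<partial>lborel \<partial>Pi\<^sub>M (insert b {a}) (\<lambda>_. lborel))"
    by (intro nn_integral_mono norm_integral_le_nn_integral)
  also have "\<dots> = (\<integral>\<^sup>+t. norm (F (t a, t b, t c)) \<partial>Pi\<^sub>M (insert c (insert b {a})) (\<lambda>_. lborel))"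
    using abc by (subst product_nn_integral_insert) auto
  also have "\<dots> < \<infinity>"
    using int' by (simp add: integrable_iff_bounded)
  finally have int2: "integrable (Pi\<^sub>M (insert b {a}) (\<lambda>_. lborel)) (\<lambda>r. ?G (r a) (r b))"
    by (intro integrableI_bounded) auto
  have "(\<integral>t. F (t a, t b, t c) \<partial>Pi\<^sub>M {a, b, c} (\<lambda>_. lborel)) =
      (\<integral>r. ?G (r a) (r b) \<partial>Pi\<^sub>M (insert b {a}) (\<lambda>_. lborel))"
    unfolding eq using abc int' by (subst product_integral_insert) auto
  also have "\<dots> = (\<integral>r. \<integral>s. ?G (r a) s \<partial>lborel \<partial>Pi\<^sub>M {a} (\<lambda>_. lborel))"
    using abc int2 by (subst product_integral_insert) auto
  also have "\<dots> = (\<integral>r. \<integral>s. ?G r s \<partial>lborel \<partial>lborel)"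
    by (rule product_integral_singleton) measurable
  finally show ?thesis .
qed

lemma indicator_box_three:
  assumes "t \<in> space (Pi\<^sub>M {a, b, c} (\<lambda>_. lborel :: real measure))"
  shows "indicator ({a, b, c} \<rightarrow>\<^sub>E {0..1}) t =
    (indicator {0..1} (t a) * indicator {0..1} (t b) * indicator {0..1} (t c) :: 'a :: semiring_1)"
  using assms by (auto simp: indicator_def space_PiM PiE_def Pi_def)

section \<open>From the unit box to triple circle integrals\<close>

lemma nn_integral_torus_three:
  fixes f :: "complex \<times> complex \<times> complex \<Rightarrow> ennreal"
  assumes abc: "distinct [a, b, c]"
    and [measurable]: "f \<in> borel_measurable (borel \<Otimes>\<^sub>M borel \<Otimes>\<^sub>M borel)"
  shows "(\<integral>\<^sup>+t. indicator ({a, b, c} \<rightarrow>\<^sub>E {0..1}) t *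
      f (cis (2 * pi * t a), cis (2 * pi * t b), cis (2 * pi * t c)) \<partial>Pi\<^sub>M {a, b, c} (\<lambda>_. lborel)) =
    (\<integral>\<^sup>+x. \<integral>\<^sup>+y. \<integral>\<^sup>+z. f (x, y, z) \<partial>circle \<partial>circle \<partial>circle)"
proof -
  define F where "F = (\<lambda>(r, s, t). indicator {0..1} r * indicator {0..1} s * indicator {0..1} t *
    f (cis (2 * pi * r), cis (2 * pi * s), cis (2 * pi * t)))"
  have [measurable]: "F \<in> borel_measurable (borel \<Otimes>\<^sub>M borel \<Otimes>\<^sub>M borel)"
    unfolding F_def by measurable
  have "(\<integral>\<^sup>+t. indicator ({a, b, c} \<rightarrow>\<^sub>E {0..1}) t *
      f (cis (2 * pi * t a), cis (2 * pi * t b), cis (2 * pi * t c)) \<partial>Pi\<^sub>M {a, b, c} (\<lambda>_. lborel)) =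
    (\<integral>\<^sup>+t. F (t a, t b, t c) \<partial>Pi\<^sub>M {a, b, c} (\<lambda>_. lborel))"
    by (intro nn_integral_cong) (simp only: indicator_box_three F_def prod.case)
  also have "\<dots> = (\<integral>\<^sup>+r. \<integral>\<^sup>+s. \<integral>\<^sup>+t. F (r, s, t) \<partial>lborel \<partial>lborel \<partial>lborel)"
    by (rule nn_integral_PiM_three) fact+
  also have "\<dots> = (\<integral>\<^sup>+x. \<integral>\<^sup>+y. \<integral>\<^sup>+z. f (x, y, z) \<partial>circle \<partial>circle \<partial>circle)"
    by (simp add: nn_integral_circle F_def nn_integral_cmult mult.assoc)
  finally show ?thesis .
qed

lemma integral_torus_three:
  fixes f :: "complex \<times> complex \<times> complex \<Rightarrow> 'a :: {banach, second_countable_topology}"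
  assumes abc: "distinct [a, b, c]"
    and [measurable]: "f \<in> borel_measurable (borel \<Otimes>\<^sub>M borel \<Otimes>\<^sub>M borel)"
    and int: "set_integrable (Pi\<^sub>M {a, b, c} (\<lambda>_. lborel)) ({a, b, c} \<rightarrow>\<^sub>E {0..1})
      (\<lambda>t. f (cis (2 * pi * t a), cis (2 * pi * t b), cis (2 * pi * t c)))"
  shows "(LINT t : ({a, b, c} \<rightarrow>\<^sub>E {0..1}) | Pi\<^sub>M {a, b, c} (\<lambda>_. lborel).
      f (cis (2 * pi * t a), cis (2 * pi * t b), cis (2 * pi * t c))) =
    (\<integral>x. \<integral>y. \<integral>z. f (x, y, z) \<partial>circle \<partial>circle \<partial>circle)"
proof -
  define F where "F = (\<lambda>(r, s, t). (indicator {0..1} r * indicator {0..1} s * indicator {0..1} t :: real) *\<^sub>R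
    f (cis (2 * pi * r), cis (2 * pi * s), cis (2 * pi * t)))"
  have [measurable]: "F \<in> borel_measurable (borel \<Otimes>\<^sub>M borel \<Otimes>\<^sub>M borel)"
    unfolding F_def by measurable
  have eq: "indicator ({a, b, c} \<rightarrow>\<^sub>E {0..1}) t *\<^sub>R
      f (cis (2 * pi * t a), cis (2 * pi * t b), cis (2 * pi * t c)) = F (t a, t b, t c)"
    if "t \<in> space (Pi\<^sub>M {a, b, c} (\<lambda>_. lborel))" for t
    using that by (simp only: indicator_box_three F_def prod.case)
  have "integrable (Pi\<^sub>M {a, b, c} (\<lambda>_. lborel)) (\<lambda>t. F (t a, t b, t c))"
    using int unfolding set_integrable_def by (simp cong: Bochner_Integration.integrable_cong add: eq)
  then have "(\<integral>t. F (t a, t b, t c) \<partial>Pi\<^sub>M {a, b, c} (\<lambda>_. lborel)) =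
      (\<integral>r. \<integral>s. \<integral>t. F (r, s, t) \<partial>lborel \<partial>lborel \<partial>lborel)"
    using abc by (intro integral_PiM_three) auto
  also have "\<dots> = (\<integral>x. \<integral>y. \<integral>z. f (x, y, z) \<partial>circle \<partial>circle \<partial>circle)"
    by (simp add: integral_circle F_def flip: scaleR_scaleR)
  finally show ?thesis
    unfolding set_lebesgue_integral_def by (simp add: eq cong: Bochner_Integration.integral_cong)
qed

subsection \<open>The polynomial and its measure\<close>

text \<open>Distinctness of the four exponent vectors lets sums over \<open>keys\<close> be expanded
  term by term.\<close>

lemma keys_lookup_linear:
  fixes k :: "nat \<Rightarrow>\<^sub>0 nat"
  defines "P \<equiv> 1 + Var 1 + Var 2 + Var 3"
  defines "m \<equiv> \<lambda>i. Poly_Mapping.single i (1 :: nat)"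
  shows "Poly_Mapping.keys P = {0, m 1, m 2, m 3}"
    and "k \<in> {0, m 1, m 2, m 3} \<Longrightarrow> Poly_Mapping.lookup P k = 1"
    and "distinct [0, m 1, m 2, m 3]"
proof -
  have ne: "m i \<noteq> 0" "m i = m j \<longleftrightarrow> i = j" for i j
  proof -
    have *: "Poly_Mapping.lookup (m i) j = (1 when i = j)" for i j
      by (simp add: m_def lookup_single)
    show "m i \<noteq> 0" using *[of i i] by auto
    show "m i = m j \<longleftrightarrow> i = j" using *[of i i] *[of j i] by (auto simp: when_def split: if_splits)
  qed
  have lookup: "Poly_Mapping.lookup P k =
      (1 when k = 0) + (1 when k = m 1) + (1 when k = m 2) + (1 when k = m 3)" for k
    by (auto simp: P_def Var_def lookup_add lookup_single lookup_one m_def when_def)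
  show "distinct [0, m 1, m 2, m 3]"
    using ne by (simp add: eq_commute[of 0])
  show one: "k \<in> {0, m 1, m 2, m 3} \<Longrightarrow> Poly_Mapping.lookup P k = 1" for k
    using ne by (auto simp: lookup eq_commute[of 0] when_def)
  have "k \<in> Poly_Mapping.keys P \<longleftrightarrow> k \<in> {0, m 1, m 2, m 3}" for k
    using one[of k] by (auto simp: in_keys_iff lookup when_def split: if_splits)
  then show "Poly_Mapping.keys P = {0, m 1, m 2, m 3}" by blast
qed

lemma poly_eval_linear:
  "poly_eval (1 + Var 1 + Var 2 + Var 3) v = 1 + v 1 + v 2 + v 3"
  using keys_lookup_linear unfolding poly_eval_def by (simp add: add.assoc)

lemma degree_in_linear: "degree_in 3 (1 + Var 1 + Var 2 + Var 3) = 1"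
  unfolding degree_in_def keys_lookup_linear by (simp add: lookup_single when_def)

lemma partial_deriv_linear: "partial_deriv 3 (1 + Var 1 + Var 2 + Var 3) = 1"
proof -
  have "partial_deriv 3 (1 + Var 1 + Var 2 + Var 3) =
      (Poly_Mapping.single (0 :: nat \<Rightarrow>\<^sub>0 nat) 1 :: cpoly)"
    using keys_lookup_linear unfolding partial_deriv_def
    by (simp add: lookup_single)
  then show ?thesis by simp
qed

lemma poly_eval_one: "poly_eval 1 v = 1"
  by (simp add: poly_eval_def)

text \<open>For fixed \<open>x\<close>, both \<open>y\<close> and \<open>z\<close> are rotated by
  \<open>x\<close>; then \<open>x\<close> is conjugated, that is, inverted. The order of integration
  never changes.\<close>

lemma integral_circle_permute:
  "(\<integral>x. \<integral>y. \<integral>z. 1 / (1 + x + y + z) \<partial>circle \<partial>circle \<partial>circle) =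
   (\<integral>x. \<integral>y. \<integral>z. x / (1 + x + y + z) \<partial>circle \<partial>circle \<partial>circle)"
proof -
  have [measurable]: "cnj \<in> borel_measurable borel"
    by (intro borel_measurable_continuous_onI continuous_intros)
  let ?f = "\<lambda>x. \<integral>y. \<integral>z. 1 / (1 + x + x * y + x * z) \<partial>circle \<partial>circle"
  have "(\<integral>y. \<integral>z. 1 / (1 + x + y + z) \<partial>circle \<partial>circle) = ?f x" if x: "norm x = 1" for x
  proof -
    have "(\<integral>y. \<integral>z. 1 / (1 + x + y + z) \<partial>circle \<partial>circle) =
        (\<integral>y. \<integral>z. 1 / (1 + x + x * y + z) \<partial>circle \<partial>circle)"
      by (rule integral_circle_mult[symmetric]) (use x in measurable)
    also have "\<dots> = ?f x"
    proof (rule Bochner_Integration.integral_cong[OF refl])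
      fix y
      show "(\<integral>z. 1 / (1 + x + x * y + z) \<partial>circle) = (\<integral>z. 1 / (1 + x + x * y + x * z) \<partial>circle)"
        by (rule integral_circle_mult[symmetric]) (use x in measurable)
    qed
    finally show ?thesis .
  qed
  then have "AE x in circle. (\<integral>y. \<integral>z. 1 / (1 + x + y + z) \<partial>circle \<partial>circle) = ?f x"
    using AE_circle_norm by (rule eventually_mono[rotated])
  then have "(\<integral>x. \<integral>y. \<integral>z. 1 / (1 + x + y + z) \<partial>circle \<partial>circle \<partial>circle) = (\<integral>x. ?f x \<partial>circle)"
    by (rule integral_cong_AE[rotated 2]) measurable
  also have "\<dots> = (\<integral>x. ?f (cnj x) \<partial>circle)"
    by (rule integral_circle_cnj[symmetric]) measurable
  also have "\<dots> = (\<integral>x. \<integral>y. \<integral>z. x / (1 + x + y + z) \<partial>circle \<partial>circle \<partial>circle)"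
  proof (rule integral_cong_AE)
    \<comment> \<open>The factor \<open>cnj x = 1/x\<close> comes out of the denominator. Where the
      denominator vanishes, both sides are 0.\<close>
    have "1 / (1 + cnj x + cnj x * y + cnj x * z) = x / (1 + x + y + z)" if "norm x = 1" for x y z :: complex
    proof -
      have x: "cnj x * x = 1"
        using that complex_norm_square[of x] by (simp only: mult.commute) simp
      then have inv: "inverse (cnj x) = x" by (rule inverse_unique)
      have "1 + cnj x + cnj x * y + cnj x * z = cnj x * (1 + x + y + z)"
        using x by (simp only: distrib_left mult_1_right add.commute[of 1 "cnj x"])
      then show ?thesis by (simp only: divide_inverse inverse_mult_distrib inv mult_1)
    qed
    then show "AE x in circle. ?f (cnj x) = (\<integral>y. \<integral>z. x / (1 + x + y + z) \<partial>circle \<partial>circle)"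
      using AE_circle_norm by (auto elim: eventually_mono)
  qed measurable
  finally show ?thesis .
qed

theorem theorem1p3:
  shows "alt_measure 3 (1 + Var 1 + Var 2 + Var 3) = 1 / 4"
proof -
  define M where "M = Pi\<^sub>M {1, 2, 3 :: nat} (\<lambda>_. lborel :: real measure)"
  define B where "B = ({1, 2, 3 :: nat} \<rightarrow>\<^sub>E {0..1 :: real})"
  define e where "e t i = cis (2 * pi * t i)" for t :: "nat \<Rightarrow> real" and i
  have norm_e: "norm (e t i) = 1" for t i
    by (simp add: e_def)
  define P where "P t = 1 + e t 1 + e t 2 + e t 3" for t
  define R where "R = (\<integral>x. \<integral>y. \<integral>z. x / (1 + x + y + z) \<partial>circle \<partial>circle \<partial>circle)"
  have B [measurable]: "B \<in> sets M"
    unfolding B_def M_def by (rule sets_PiM_I_finite) auto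
  have [measurable]: "(\<lambda>t. e t i) \<in> borel_measurable M" if "i \<in> {1, 2, 3}" for i
    using that unfolding e_def M_def by measurable
  have P [measurable]: "P \<in> borel_measurable M"
    unfolding P_def by measurable

  have fin: "(\<integral>\<^sup>+t. indicator B t * inverse (ennreal (norm (P t))) \<partial>M) < \<infinity>"
    using nn_integral_torus_three[of 1 2 "3 :: nat" "\<lambda>(x, y, z). inverse (ennreal (norm (1 + x + y + z)))"]
      nn_integral_inverse_norm_finite
    by (simp add: M_def B_def P_def e_def)
  \<comment> \<open>All four numerators have norm 1, so one domination covers them. At zeros of
    \<open>P\<close> the quotient is 0 and the bound is infinite on \<open>B\<close>.\<close>
  have int: "set_integrable M B (\<lambda>t. w t / P t)"
    if [measurable]: "w \<in> borel_measurable M" and w: "\<And>t. norm (w t) = 1" for w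
    unfolding set_integrable_def
  proof (rule integrableI_bounded)
    have "(\<integral>\<^sup>+t. ennreal (norm (indicator B t *\<^sub>R (w t / P t))) \<partial>M) \<le>
        (\<integral>\<^sup>+t. indicator B t * inverse (ennreal (norm (P t))) \<partial>M)"
    proof (rule nn_integral_mono)
      fix t
      show "ennreal (norm (indicator B t *\<^sub>R (w t / P t))) \<le> indicator B t * inverse (ennreal (norm (P t)))"
        by (cases "P t = 0") (auto simp: w norm_divide indicator_def inverse_ennreal inverse_eq_divide)
    qed
    then show "(\<integral>\<^sup>+t. ennreal (norm (indicator B t *\<^sub>R (w t / P t))) \<partial>M) < \<infinity>"
      using fin by (rule le_less_trans)
  qed measurable

  \<comment> \<open>Taking the numerator's index \<open>a\<close> as the outermost variable turns
    each of the three integrals into the same iterated integral, since \<open>P\<close> is symmetric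
    in the indices.\<close>
  have eR: "(LINT t : B | M. e t a / P t) = R"
    if abc: "distinct [a, b, c]" "{a, b, c} = {1, 2, 3}" for a b c
  proof -
    have P': "1 + e t a + e t b + e t c = P t" for t
    proof -
      have "(\<Sum>i\<in>{a, b, c}. e t i) = (\<Sum>i\<in>{1, 2, 3}. e t i)" by (simp only: abc)
      then show ?thesis using abc(1) by (simp add: P_def add.assoc)
    qed
    have "a \<in> {1, 2, 3}" using abc(2) by blast
    then have "set_integrable M B (\<lambda>t. e t a / P t)"
      by (intro int) (auto simp: norm_e)
    then show ?thesis
      using integral_torus_three[OF abc(1), of "\<lambda>(x, y, z). x / (1 + x + y + z)"]
      by (simp only: prod.case R_def abc(2) M_def B_def P' e_def[symmetric]) simp
  qed
  have one: "(LINT t : B | M. 1 / P t) = R"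
    using integral_torus_three[of 1 2 "3 :: nat" "\<lambda>(x, y, z). 1 / (1 + x + y + z)"] int[of "\<lambda>_. 1"]
      integral_circle_permute
    by (simp add: M_def B_def P_def e_def R_def)

  \<comment> \<open>A finite integral forces a finite integrand almost everywhere, and the
    reciprocal is infinite at zeros of \<open>P\<close>. So the zeros in \<open>B\<close> are null;
    at them the four quotients would add up to 0 instead of 1.\<close>
  have "AE t in M. indicator B t * inverse (ennreal (norm (P t))) \<noteq> \<infinity>"
    by (rule nn_integral_noteq_infinite) (use fin in auto)
  then have nz: "AE t in M. t \<in> B \<longrightarrow> P t \<noteq> 0"
    by eventually_elim auto
  have "4 * R = (LINT t : B | M. 1 / P t) + (LINT t : B | M. e t 1 / P t)
      + (LINT t : B | M. e t 2 / P t) + (LINT t : B | M. e t 3 / P t)"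
    using eR[of 1 2 3] eR[of 2 1 3] eR[of 3 1 2] one by (simp add: insert_commute)
  also have "\<dots> = (LINT t : B | M. 1 / P t + e t 1 / P t + e t 2 / P t + e t 3 / P t)"
  proof -
    have "set_integrable M B (\<lambda>t. 1 / P t)" by (rule int) auto
    moreover have "set_integrable M B (\<lambda>t. e t i / P t)" if "i \<in> {1, 2, 3}" for i
      by (rule int) (use that in \<open>auto simp: norm_e\<close>)
    ultimately show ?thesis by (simp add: set_integral_add)
  qed
  also have "\<dots> = (LINT t : B | M. 1)"
    by (rule set_lebesgue_integral_cong_AE)
       (use nz in \<open>auto simp: P_def simp flip: add_divide_distrib\<close>)
  also have "\<dots> = (1 :: complex)"
  proof -
    have "(\<integral>\<^sup>+t. indicator B t \<partial>M) = 1"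
      using nn_integral_torus_three[of 1 2 "3 :: nat" "\<lambda>_. 1"]
      by (simp add: M_def B_def emeasure_circle_space)
    then have "emeasure M B = 1" by simp
    then show ?thesis
      by (simp add: set_lebesgue_integral_def measure_def)
  qed
  finally have R: "R = 1 / 4" by (simp add: field_simps)

  \<comment> \<open>The degree and the derivative in the last variable are both 1, which leaves
    exactly the integral with numerator \<open>e t 3\<close>.\<close>
  have "torus_point t i = e t i" for t i
    by (simp add: torus_point_def e_def cis_conv_exp mult_ac)
  moreover have "{1..3 :: nat} = {1, 2, 3}" by auto
  ultimately have "alt_measure 3 (1 + Var 1 + Var 2 + Var 3) = (LINT t : B | M. e t 3 / P t)"
    unfolding alt_measure_def alt_measure_wrt_def degree_in_linear partial_deriv_linear
      poly_eval_linear poly_eval_one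
    by (simp add: M_def B_def P_def)
  also have "\<dots> = 1 / 4"
    using eR[of 3 1 2] R by (simp add: insert_commute)
  finally show ?thesis .
qed

end
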